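(* Let $P_0$ and $P_1$ be probability distributions on a measurable space $\mathcal{Z}$, and let $\theta_0 = \theta(P_0) \in \mathbb{R}^d$ and $\theta_1 = \theta(P_1) \in \mathbb{R}^d$ be the values of a parameter of interest at $P_0$ and $P_1$. Let $\ell : \mathbb{R}_+ \to \mathbb{R}_+$ be non-decreasing and convex, and define $\Delta = 2\,\ell\left(\tfrac12 \|\theta_0 - \theta_1\|_2\right)$. Let $\delta \in [0,\infty)$. If the estimator $\widehat{\theta} : \mathcal{Z} \to \mathbb{R}^d$ satisfies $R(\widehat{\theta}, P_0) \le \delta$, then $$R(\widehat{\theta}, P_1) \ge \left[\Delta^{1/2} - \left(\rho(P_1 \| P_0)\, \delta\right)^{1/2}\right]_+^2 .$$
   Context: $\mathbb{R}_+ = [0,\infty)$, $\|\cdot\|_2$ is the Euclidean norm, and $[x]_+ = \max\{x,0\}$. An estimator is a measurable map $\widehat\theta : \mathcal{Z} \to \mathbb{R}^d$. Its risk under a distribution $P$ with parameter $\theta(P)$ is $R(\widehat\theta, P) = \mathbb{E}_P\left[\ell(\|\widehat\theta(Z) - \theta(P)\|_2)\right]$, where $Z \sim P$ (possibly $+\infty$). The $\chi^2$-affinity is $\rho(P_1\|P_0) = D_{\chi^2}(P_1\|P_0) + 1 = \int \frac{dP_1^2}{dP_0} = \mathbb{E}_{P_0}\left[\left(\frac{dP_1}{dP_0}\right)^2\right]$, with $\rho(P_1\|P_0) = +\infty$ if $P_1$ is not absolutely continuous with respect to $P_0$; when $\rho(P_1\|P_0)=+\infty$ the right-hand side of the inequality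 is interpreted as $0$. *)

theory Defs
  imports "HOL-Probability.Probability"
begin

text \<open>Extended-valued, since the expected loss may be infinite.\<close>

definition risk ::
  "(real \<Rightarrow> real) \<Rightarrow> ('z measure \<Rightarrow> real ^ 'd) \<Rightarrow> ('z \<Rightarrow> real ^ 'd) \<Rightarrow> 'z measure \<Rightarrow> ennreal"
  where "risk loss \<theta> est P = (\<integral>\<^sup>+ z. ennreal (loss (norm (est z - \<theta> P))) \<partial>P)"

text \<open>
  The affinity of \<open>P1\<close> relative to \<open>P0\<close>. In the library, both
  \<open>absolutely_continuous\<close> and \<open>RN_deriv\<close> take the dominating measure first, so the
  condition reads ``\<open>P1\<close> is absolutely continuous with respect to \<open>P0\<close>''.
\<close>

definition chi2_affinity :: "'z measure \<Rightarrow> 'z measure \<Rightarrow> ennreal"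
  where "chi2_affinity P1 P0 =
    (if absolutely_continuous P0 P1 then (\<integral>\<^sup>+ z. (RN_deriv P0 P1 z)\<^sup>2 \<partial>P0) else \<infinity>)"

end

theory Submission
  imports Defs
begin

text \<open>
  The triangle inequality and convexity give \<open>\<Delta> \<le> a + b\<close> pointwise, where \<open>a\<close> and \<open>b\<close> are the
  losses at \<open>\<theta> P0\<close> and \<open>\<theta> P1\<close>. Hence \<open>\<surd>\<Delta> \<le> \<surd>a + \<surd>b\<close>, which is integrated under \<open>P1\<close>. Cauchy--Schwarz
  bounds the integral of \<open>\<surd>b\<close> by the root of the risk under \<open>P1\<close> and, after the change of measure
  to \<open>P0\<close>, the integral of \<open>\<surd>a\<close> by the root of the affinity times the risk under \<open>P0\<close>.
\<close>

text \<open>Monotonicity is known only on the nonnegative reals. Precomposing \<open>loss\<close>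
  with \<open>max 0\<close> makes it monotone on the whole line, hence Borel, and changes nothing at
  a norm.\<close>

lemma borel_measurable_loss_norm:
  fixes loss :: "real \<Rightarrow> real" and f :: "'z \<Rightarrow> 'b::{real_normed_vector, second_countable_topology}"
  assumes "mono_on {0..} loss" and f: "f \<in> borel_measurable M"
  shows "(\<lambda>z. loss (norm (f z - c))) \<in> borel_measurable M"
proof -
  have "mono (\<lambda>t. loss (max 0 t))"
    by (intro monoI mono_onD[OF assms(1)]) auto
  then have [measurable]: "(\<lambda>t. loss (max 0 t)) \<in> borel_measurable borel"
    by (rule borel_measurable_mono)
  have "(\<lambda>z. (\<lambda>t. loss (max 0 t)) (norm (f z - c))) \<in> borel_measurable M"
    using f by measurable
  then show ?thesis
    by (simp add: max_absorb2)
qed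

text \<open>Half the distance from \<open>u\<close> to \<open>v\<close> is at most the midpoint of
  the distances from \<open>x\<close>. Convexity with weight 1/2 then applies, and the factor 2
  clears the weights.\<close>

lemma convex_loss_half_dist_le:
  fixes loss :: "real \<Rightarrow> real" and x u v :: "'b::real_normed_vector"
  assumes "mono_on {0..} loss" and "convex_on {0..} loss"
  shows "2 * loss (1 / 2 * norm (u - v)) \<le> loss (norm (x - u)) + loss (norm (x - v))"
proof -
  have "norm (u - v) \<le> norm (x - u) + norm (x - v)"
    using norm_triangle_ineq4[of "x - v" "x - u"] by simp
  then have "loss (1 / 2 * norm (u - v)) \<le> loss ((1 / 2) * norm (x - u) + (1 / 2) * norm (x - v))"
    by (intro mono_onD[OF assms(1)]) auto
  also have "\<dots> \<le> (1 / 2) * loss (norm (x - u)) + (1 / 2) * loss (norm (x - v))"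
    using convex_onD[OF assms(2), of "1/2" "norm (x - u)" "norm (x - v)"] by simp
  finally show ?thesis
    by simp
qed

lemma ennreal_le_sqrtI:
  assumes "x\<^sup>2 \<le> ennreal c" and "c \<ge> 0"
  shows "x \<le> ennreal (sqrt c)"
proof (cases x)
  case (real y)
  then have "y\<^sup>2 \<le> c"
    using assms by (simp add: ennreal_power)
  then show ?thesis
    using real by (simp add: ennreal_leI real_le_rsqrt)
next
  case top
  then show ?thesis
    using assms(1) by (simp add: power2_eq_square top_unique)
qed

lemma (in prob_space) nn_integral_power2_le:
  assumes [measurable]: "f \<in> borel_measurable M"
  shows "(\<integral>\<^sup>+ z. f z \<partial>M)\<^sup>2 \<le> (\<integral>\<^sup>+ z. (f z)\<^sup>2 \<partial>M)"
  using Cauchy_Schwarz_nn_integral[of f M "\<lambda>_. 1"] by (simp add: emeasure_space_1)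

text \<open>The density moves the integral to \<open>P0\<close>, and Cauchy--Schwarz splits off its
  second moment, which is the affinity. Finiteness of the affinity supplies absolute continuity.
  Without it, an \<open>f\<close> living on a \<open>P0\<close>-null set could make the right side
  \<infinity> * 0 = 0.\<close>

lemma nn_integral_power2_le_chi2_affinity:
  assumes "sigma_finite_measure P0" and "sets P1 = sets P0" and "chi2_affinity P1 P0 \<noteq> \<infinity>"
    and f [measurable]: "f \<in> borel_measurable P0"
  shows "(\<integral>\<^sup>+ z. f z \<partial>P1)\<^sup>2 \<le> chi2_affinity P1 P0 * (\<integral>\<^sup>+ z. (f z)\<^sup>2 \<partial>P0)"
proof -
  have ac: "absolutely_continuous P0 P1"
    using assms(3) by (auto simp: chi2_affinity_def split: if_splits)
  have "(\<integral>\<^sup>+ z. f z \<partial>P1) = (\<integral>\<^sup>+ z. RN_deriv P0 P1 z * f z \<partial>P0)"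
    by (intro sigma_finite_measure.RN_deriv_nn_integral assms ac)
  then show ?thesis
    using Cauchy_Schwarz_nn_integral[of "RN_deriv P0 P1" P0 f] ac
    by (simp add: chi2_affinity_def)
qed

theorem theorem1:
  fixes Z P0 P1 :: "'z measure"
    and \<theta> :: "'z measure \<Rightarrow> real ^ 'd"
    and est :: "'z \<Rightarrow> real ^ 'd"
    and loss :: "real \<Rightarrow> real"
    and \<Delta> \<delta> :: real
  assumes "prob_space P0" and "sets P0 = sets Z"
    and "prob_space P1" and "sets P1 = sets Z"
    and "\<And>t. t \<ge> 0 \<Longrightarrow> loss t \<ge> 0"
    and "mono_on {0..} loss"
    and "convex_on {0..} loss"
    and "\<Delta> = 2 * loss (1 / 2 * norm (\<theta> P0 - \<theta> P1))"
    and "\<delta> \<ge> 0"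
    and "est \<in> borel_measurable Z"
    and "risk loss \<theta> est P0 \<le> ennreal \<delta>"
  shows "risk loss \<theta> est P1 \<ge>
    (if chi2_affinity P1 P0 = \<infinity> then 0
     else ennreal ((max (sqrt \<Delta> - sqrt (enn2real (chi2_affinity P1 P0) * \<delta>)) 0)\<^sup>2))"
\<comment> \<open>An infinite affinity makes the lower bound 0, and an infinite risk exceeds any
  bound. Otherwise both are finite and can be replaced by the reals \<open>\<rho>\<close> and
  \<open>r\<close>.\<close>
proof (cases "chi2_affinity P1 P0 = \<infinity> \<or> risk loss \<theta> est P1 = \<infinity>")
  case True
  then show ?thesis
    by auto
next
  case False
  then have fin: "chi2_affinity P1 P0 \<noteq> \<infinity>" "risk loss \<theta> est P1 \<noteq> \<infinity>"
    by auto
  interpret P0: prob_space P0 by fact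
  interpret P1: prob_space P1 by fact
  define a where "a z = loss (norm (est z - \<theta> P0))" for z
  define b where "b z = loss (norm (est z - \<theta> P1))" for z
  define X where "X = (\<integral>\<^sup>+ z. ennreal (sqrt (a z)) \<partial>P1)"
  define Y where "Y = (\<integral>\<^sup>+ z. ennreal (sqrt (b z)) \<partial>P1)"
  define \<rho> where "\<rho> = enn2real (chi2_affinity P1 P0)"
  define r where "r = enn2real (risk loss \<theta> est P1)"
  have \<rho>: "chi2_affinity P1 P0 = ennreal \<rho>" "\<rho> \<ge> 0"
    using fin by (auto simp: \<rho>_def less_top)
  have r: "risk loss \<theta> est P1 = ennreal r" "r \<ge> 0"
    using fin by (auto simp: r_def less_top)
  have nonneg: "a z \<ge> 0" "b z \<ge> 0" for z
    by (auto simp: a_def b_def intro: assms(5))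
  have est: "est \<in> borel_measurable P0" "est \<in> borel_measurable P1"
    using assms(10) by (simp_all cong: measurable_cong_sets add: assms(2,4))
  have [measurable]: "a \<in> borel_measurable P0" "a \<in> borel_measurable P1" "b \<in> borel_measurable P1"
    unfolding a_def b_def by (intro borel_measurable_loss_norm assms(6) est)+
  have sq: "(ennreal (sqrt (a z)))\<^sup>2 = ennreal (a z)" "(ennreal (sqrt (b z)))\<^sup>2 = ennreal (b z)" for z
    using nonneg[of z] by (simp_all add: ennreal_power)
  have risk: "risk loss \<theta> est P0 = (\<integral>\<^sup>+ z. ennreal (a z) \<partial>P0)"
    "risk loss \<theta> est P1 = (\<integral>\<^sup>+ z. ennreal (b z) \<partial>P1)"
    by (simp_all add: risk_def a_def b_def)

  have "X\<^sup>2 \<le> chi2_affinity P1 P0 * risk loss \<theta> est P0"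
    using nn_integral_power2_le_chi2_affinity[of P0 P1 "\<lambda>z. ennreal (sqrt (a z))"] fin
    by (simp add: X_def sq assms(2,4) P0.sigma_finite_measure_axioms risk)
  also have "\<dots> \<le> ennreal \<rho> * ennreal \<delta>"
    unfolding \<rho> by (intro mult_left_mono assms(11)) auto
  finally have "X\<^sup>2 \<le> ennreal (\<rho> * \<delta>)"
    using \<rho> assms(9) by (simp add: ennreal_mult)
  then have X: "X \<le> ennreal (sqrt (\<rho> * \<delta>))"
    using \<rho> assms(9) by (intro ennreal_le_sqrtI) auto
  \<comment> \<open>No change of measure here: Cauchy--Schwarz against the constant 1 under
    \<open>P1\<close> suffices.\<close>
  have "Y\<^sup>2 \<le> ennreal r"
    using P1.nn_integral_power2_le[of "\<lambda>z. ennreal (sqrt (b z))"] r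
    by (simp add: Y_def sq risk)
  then have Y: "Y \<le> ennreal (sqrt r)"
    using r by (intro ennreal_le_sqrtI)

  have "sqrt \<Delta> \<le> sqrt (a z) + sqrt (b z)" for z
  proof -
    have "\<Delta> \<le> a z + b z"
      unfolding a_def b_def assms(8) by (intro convex_loss_half_dist_le assms(6,7))
    then show ?thesis
      using sqrt_add_le_add_sqrt[OF nonneg[of z]] by (meson order_trans real_sqrt_le_mono)
  qed
  \<comment> \<open>Since \<open>P1\<close> has total mass 1, the left side is just
    \<open>sqrt \<Delta>\<close>.\<close>
  then have "(\<integral>\<^sup>+ z. ennreal (sqrt \<Delta>) \<partial>P1) \<le> (\<integral>\<^sup>+ z. ennreal (sqrt (a z)) + ennreal (sqrt (b z)) \<partial>P1)"
    using nonneg by (intro nn_integral_mono) (simp flip: ennreal_plus)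
  also have "\<dots> = X + Y"
    unfolding X_def Y_def by (rule nn_integral_add) auto
  also have "\<dots> \<le> ennreal (sqrt (\<rho> * \<delta>)) + ennreal (sqrt r)"
    by (intro add_mono X Y)
  finally have "sqrt \<Delta> \<le> sqrt (\<rho> * \<delta>) + sqrt r"
    using \<rho> r assms(9) by (simp add: P1.emeasure_space_1 flip: ennreal_plus)
  \<comment> \<open>\<open>sqrt r\<close> dominates both the difference and 0. Taking the positive
    part first makes squaring monotone even when the difference is negative.\<close>
  then have "(max (sqrt \<Delta> - sqrt (\<rho> * \<delta>)) 0)\<^sup>2 \<le> (sqrt r)\<^sup>2"
    using r by (intro power_mono) auto
  then show ?thesis
    using fin r by (simp add: ennreal_leI flip: \<rho>_def)
qed

end
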